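(* Let $f:\{0,1\}^3\to\{0,1\}$ be a Boolean function of three variables. Then $ess(f)=3$ and $gap(f)=2$ (i.e. $f\in G_2^3$) if and only if, after a suitable permutation of the variables $x_1,x_2,x_3$, $f$ can be represented in one of the forms $$f=x_3^\alpha(x_1^0x_2^1\oplus x_1^1x_2^0)\oplus x_1^\beta x_2^\beta$$ or $$f=x_3^\alpha(x_1^0x_2^0\oplus x_1^1x_2^1)\oplus x_3^{\neg(\alpha)}(x_1^0x_2^1\oplus x_1^1x_2^0),$$ where $\alpha,\beta\in\{0,1\}$.
   Context: $B=\{0,1\}$ is the ring of residues modulo $2$, with addition $\oplus$ and multiplication modulo $2$; $\neg(\alpha)=1\oplus\alpha$. $P_2^n$ is the set of all functions $f:B^n\to B$, with variables $x_1,\ldots,x_n$. For $\alpha\in B$, $x^\alpha=1$ if $x=\alpha$ and $x^\alpha=0$ otherwise. A variable $x_i$ is essential in $f$ if changing the $i$-th argument alone changes the value of $f$ at some point; $Ess(f)$ is the set of essential variables and $ess(f)=|Ess(f)|$. For $i\neq j$, the identification minor $f_{i\leftarrow j}$ is the function obtained from $f$ by substituting $x_j$ for $x_i$ (regarded as a function of $x_1,\ldots,x_n$). The essential arity gap is $gap(f)=ess(f)-\max ess(f_{i\leftarrow j})$, the maximum being over all pairs of distinct essential variables $x_i,x_j$ of $f$. $G_2^3$ is the set of $f\in P_2^3$ with $ess(f)=3$ and $gap(f)=2$. *)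

theory Defs
  imports Complex_Main "HOL-Library.Z2" "HOL-Library.Numeral_Type"
begin

text \<open>
  The ring $B$ of residues modulo 2 is the type \<^typ>\<open>bit\<close>.  An element of $P_2^n$ is a function
  \<open>f :: ('n \<Rightarrow> bit) \<Rightarrow> bit\<close> where \<open>'n\<close> is a finite type with $n$ elements; the variables
  are the elements of \<open>'n\<close>.  For $n = 3$ we use the numeral type \<^typ>\<open>3\<close>, whose three
  elements are 1, 2 and 3 (numerals of this type are read modulo 3, so 3 and 0 coincide).
\<close>

abbreviation neg :: "bit \<Rightarrow> bit" where
  "neg \<alpha> \<equiv> 1 + \<alpha>"

definition var_pow :: "bit \<Rightarrow> bit \<Rightarrow> bit"  (infixr "\<up>" 80) where
  "x \<up> \<alpha> = (if x = \<alpha> then 1 else 0)"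

definition essential :: "(('n::finite \<Rightarrow> bit) \<Rightarrow> bit) \<Rightarrow> 'n \<Rightarrow> bool" where
  "essential f i \<longleftrightarrow> (\<exists>x b. f (x(i := b)) \<noteq> f x)"

definition Ess :: "(('n::finite \<Rightarrow> bit) \<Rightarrow> bit) \<Rightarrow> 'n set" where
  "Ess f = {i. essential f i}"

definition ess :: "(('n::finite \<Rightarrow> bit) \<Rightarrow> bit) \<Rightarrow> nat" where
  "ess f = card (Ess f)"

definition minor :: "(('n::finite \<Rightarrow> bit) \<Rightarrow> bit) \<Rightarrow> 'n \<Rightarrow> 'n \<Rightarrow> (('n \<Rightarrow> bit) \<Rightarrow> bit)" where
  "minor f i j = (\<lambda>x. f (x(i := x j)))"

text \<open>
  The maximum is over a nonempty set exactly when \<open>ess f \<ge> 2\<close>; for other \<open>f\<close> the value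
  of \<open>gap f\<close> is unspecified.
\<close>

definition gap :: "(('n::finite \<Rightarrow> bit) \<Rightarrow> bit) \<Rightarrow> int" where
  "gap f = int (ess f) - int (Max {ess (minor f i j) | i j. i \<in> Ess f \<and> j \<in> Ess f \<and> i \<noteq> j})"

definition G_2_3 :: "((3 \<Rightarrow> bit) \<Rightarrow> bit) set" where
  "G_2_3 = {f. ess f = 3 \<and> gap f = 2}"

end

theory Submission
  imports Defs "HOL-Analysis.Cartesian_Space"
begin

text \<open>
  \<open>G_2_3\<close> consists of the self-dual functions (those with \<open>f (\<not> x) = \<not> (f x)\<close>) that depend on all
  three variables.  A minor of a self-dual function is a self-dual function of at most two variables,
  hence a variable or its negation.  Conversely, suppose that every minor depends on at most one
  variable.  If \<open>f\<close> agrees at \<open>(0,0,0)\<close> and \<open>(1,1,1)\<close>, every minor is constant; otherwise every minor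
  is self-dual.  Since among three bits two always coincide, \<open>f\<close> itself is constant in the first case
  and self-dual in the second.  A self-dual function is determined by its values at \<open>(0,0,0)\<close>,
  \<open>(1,0,0)\<close>, \<open>(0,1,0)\<close>, \<open>(0,0,1)\<close>, and inspecting these values gives the two normal forms.
\<close>

section \<open>Bits, indices and points with two equal coordinates\<close>

lemma all_bit: "(\<forall>b::bit. P b) \<longleftrightarrow> P 0 \<and> P 1"
  by (metis bit.exhaust)

lemma ex_bit: "(\<exists>b::bit. P b) \<longleftrightarrow> P 0 \<or> P 1"
  by (metis bit.exhaust)

lemma ex_bit_neq: "(\<exists>a d::bit. P d \<noteq> P a) \<longleftrightarrow> P 0 \<noteq> P 1"
  unfolding ex_bit by auto

definition self_dual :: "(('n::finite \<Rightarrow> bit) \<Rightarrow> bit) \<Rightarrow> bool" where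
  "self_dual f \<longleftrightarrow> (\<forall>x. f (\<lambda>i. neg (x i)) = neg (f x))"

text \<open>For three indices these are the points seen by a minor that identifies the two indices
  other than \<open>k\<close>: \<open>a\<close> is their common value.\<close>

definition all_but :: "'n \<Rightarrow> bit \<Rightarrow> bit \<Rightarrow> 'n \<Rightarrow> bit" where
  "all_but k a b = (\<lambda>l. if l = k then b else a)"

lemma third_index:
  fixes i j :: 3
  assumes "i \<noteq> j"
  obtains k where "k \<noteq> i" "k \<noteq> j" "\<And>l. l = i \<or> l = j \<or> l = k"
proof -
  have "card (UNIV - {i, j}) = 1"
    using assms by (simp add: card_Diff_subset)
  then obtain k where "UNIV - {i, j} = {k}"
    by (rule card_1_singletonE)
  then have "k \<noteq> i" "k \<noteq> j" "l = i \<or> l = j \<or> l = k" for l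
    by blast+
  then show ?thesis
    using that by blast
qed

lemma other_indices:
  fixes k :: 3
  obtains i j where "i \<noteq> j" "k \<noteq> i" "k \<noteq> j" "\<And>l. l = i \<or> l = j \<or> l = k"
proof -
  have "\<exists>i. i \<noteq> k"
    by (cases "k = 0") (auto intro: exI[of _ 0] exI[of _ 1])
  then obtain i where "i \<noteq> k"
    by blast
  moreover obtain j where "j \<noteq> i" "j \<noteq> k" "\<And>l. l = i \<or> l = k \<or> l = j"
    using third_index[OF \<open>i \<noteq> k\<close>] by blast
  ultimately show ?thesis
    using that[of i j] by blast
qed

text \<open>Pigeonhole: two of three bits coincide, and \<open>k\<close> is the remaining index.
  Hence the minors together determine \<open>f\<close>.\<close>

lemma all_but_cases:
  fixes x :: "3 \<Rightarrow> bit"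
  obtains k a b where "x = all_but k a b"
proof -
  have "x 1 = x 2 \<or> x 1 = x 3 \<or> x 2 = x 3"
    by (cases "x 1"; cases "x 2"; cases "x 3") simp_all
  moreover have "(1::3) \<noteq> 2" "(1::3) \<noteq> 3" "(2::3) \<noteq> 3"
    by simp_all
  ultimately obtain i j where ij: "i \<noteq> j" "x i = x j"
    by metis
  then obtain k where k: "k \<noteq> i" "k \<noteq> j" "\<And>l. l = i \<or> l = j \<or> l = k"
    using third_index by blast
  then have "x = all_but k (x i) (x k)"
    using ij by (fastforce simp: all_but_def)
  then show ?thesis
    using that by blast
qed

section \<open>Essential arity of identification minors\<close>

lemma essential_two_variables:
  assumes "\<And>x. g x = h (x j) (x k)" "j \<noteq> k"
  shows "essential g l \<longleftrightarrow>
    l = j \<and> (\<exists>b. h 0 b \<noteq> h 1 b) \<or> l = k \<and> (\<exists>a. h a 0 \<noteq> h a 1)"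
proof
  assume "essential g l"
  then obtain x b where "g (x(l := b)) \<noteq> g x"
    unfolding essential_def by blast
  then show "l = j \<and> (\<exists>b. h 0 b \<noteq> h 1 b) \<or> l = k \<and> (\<exists>a. h a 0 \<noteq> h a 1)"
    using assms(2) by (auto simp: assms(1) split: if_splits) (metis bit.exhaust)+
next
  \<comment> \<open>The witness has \<open>1\<close> at \<open>j\<close> and \<open>b\<close> at
    \<open>k\<close>; resetting coordinate \<open>j\<close> to \<open>0\<close> turns
    \<open>h 1 b\<close> into \<open>h 0 b\<close>.\<close>
  have j: "essential g j" if "h 0 b \<noteq> h 1 b" for b
    unfolding essential_def
    by (rule exI[of _ "all_but k 1 b"], rule exI[of _ 0])
      (use that assms in \<open>auto simp: all_but_def\<close>)
  have k: "essential g k" if "h a 0 \<noteq> h a 1" for a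
    unfolding essential_def
    by (rule exI[of _ "all_but k a 1"], rule exI[of _ 0])
      (use that assms in \<open>auto simp: all_but_def\<close>)
  show "essential g l" if "l = j \<and> (\<exists>b. h 0 b \<noteq> h 1 b) \<or> l = k \<and> (\<exists>a. h a 0 \<noteq> h a 1)"
    using that j k by blast
qed

lemma ess_two_variables:
  assumes "\<And>x. g x = h (x j) (x k)" "j \<noteq> k"
  shows "ess g = of_bool (\<exists>b. h 0 b \<noteq> h 1 b) + of_bool (\<exists>a. h a 0 \<noteq> h a 1)"
proof -
  have "Ess g = {l. l = j \<and> (\<exists>b. h 0 b \<noteq> h 1 b)} \<union> {l. l = k \<and> (\<exists>a. h a 0 \<noteq> h a 1)}"
    unfolding Ess_def using essential_two_variables[of g h j k, OF assms] by blast
  then show ?thesis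
    using assms(2) by (auto simp: ess_def card_insert_if simp del: ex_simps)
qed

text \<open>Once \<open>x i\<close> is replaced by \<open>x j\<close>, only \<open>x j\<close> and
  \<open>x k\<close> remain visible. The two summands test dependence on \<open>x j\<close> and on
  \<open>x k\<close>.\<close>

lemma ess_minor:
  fixes f :: "(3 \<Rightarrow> bit) \<Rightarrow> bit"
  assumes "i \<noteq> j" "k \<noteq> i" "k \<noteq> j" "\<And>l. l = i \<or> l = j \<or> l = k"
  shows "ess (minor f i j) =
    of_bool (\<exists>b. f (all_but k 0 b) \<noteq> f (all_but k 1 b)) +
    of_bool (\<exists>a. f (all_but k a 0) \<noteq> f (all_but k a 1))"
proof (rule ess_two_variables)
  show "minor f i j x = f (all_but k (x j) (x k))" for x
  proof -
    have "x(i := x j) = all_but k (x j) (x k)"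
      using assms by (fastforce simp: all_but_def)
    then show ?thesis
      by (simp add: minor_def)
  qed
qed (use assms in simp)

section \<open>Self-duality and minors of arity at most one\<close>

lemma neg_all_but: "(\<lambda>l. neg (all_but k a b l)) = all_but k (neg a) (neg b)"
  by (auto simp: all_but_def)

text \<open>Write h(a,b) for \<open>f (all_but k a b)\<close>; by self-duality h(0,0) and h(0,1)
  determine h. If they agree, h depends on a alone; if they differ, on b alone.\<close>

lemma self_dual_minor:
  fixes f :: "(3 \<Rightarrow> bit) \<Rightarrow> bit"
  assumes "self_dual f" "i \<noteq> j"
  shows "ess (minor f i j) = 1"
proof -
  obtain k where k: "k \<noteq> i" "k \<noteq> j" "\<And>l. l = i \<or> l = j \<or> l = k"
    using third_index[OF assms(2)] by blast
  have "f (all_but k (neg a) (neg b)) = neg (f (all_but k a b))" for a b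
    using assms(1) unfolding self_dual_def neg_all_but[symmetric] by blast
  from this[of 0 0] this[of 0 1] show ?thesis
    unfolding ess_minor[of i j k, OF assms(2) k] ex_bit
    by (cases "f (all_but k 0 0)"; cases "f (all_but k 0 1)") auto
qed

text \<open>\<open>nonconst\<close> excludes the constant functions, whose minors all have arity
  0.\<close>

lemma self_dualI:
  fixes f :: "(3 \<Rightarrow> bit) \<Rightarrow> bit"
  assumes ess: "\<And>i j. i \<noteq> j \<Longrightarrow> ess (minor f i j) \<le> 1"
    and nonconst: "f x \<noteq> f y"
  shows "self_dual f"
proof -
  have diag: "all_but k a a = (\<lambda>_. a)" for k :: 3 and a
    by (auto simp: all_but_def)
  \<comment> \<open>The minor ignores one of its two arguments: in the first alternative the value
    shared by the indices other than \<open>k\<close>, in the second the value at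
    \<open>k\<close>.\<close>
  have cases: "(f (\<lambda>_. 0) = f (all_but k 1 0) \<and> f (all_but k 0 1) = f (\<lambda>_. 1)) \<or>
      (f (\<lambda>_. 0) = f (all_but k 0 1) \<and> f (all_but k 1 0) = f (\<lambda>_. 1))" for k
  proof -
    obtain i j where ij: "i \<noteq> j" "k \<noteq> i" "k \<noteq> j" "\<And>l. l = i \<or> l = j \<or> l = k"
      using other_indices by blast
    show ?thesis
      using ess[OF ij(1)] unfolding ess_minor[of i j k, OF ij] ex_bit diag
      by (auto simp: of_bool_def split: if_splits)
  qed
  have "f (\<lambda>_. 0) \<noteq> f (\<lambda>_. 1)"
  proof
    assume eq: "f (\<lambda>_. 0) = f (\<lambda>_. 1)"
    \<comment> \<open>In either alternative \<open>eq\<close> forces one value on all four points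
      \<open>all_but k a b\<close>, and these cover the cube as \<open>k\<close> varies.\<close>
    have "f z = f (\<lambda>_. 0)" for z
    proof -
      obtain k a b where z: "z = all_but k a b"
        using all_but_cases by blast
      show ?thesis
        using cases[of k] eq unfolding z by (cases a; cases b) (auto simp: diag)
    qed
    with nonconst show False
      by metis
  qed
  then have neg: "f (\<lambda>_. 1) = neg (f (\<lambda>_. 0))"
    by (cases "f (\<lambda>_. 0)"; cases "f (\<lambda>_. 1)") auto
  show ?thesis
    unfolding self_dual_def
  proof
    fix z :: "3 \<Rightarrow> bit"
    obtain k a b where z: "z = all_but k a b"
      using all_but_cases by blast
    \<comment> \<open>Of the antipodal points \<open>all_but k 1 0\<close> and
      \<open>all_but k 0 1\<close>, one shares its value with the all-zero point, the other with the
      all-one point.\<close>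
    show "f (\<lambda>i. neg (z i)) = neg (f z)"
      using cases[of k] neg unfolding z neg_all_but
      by (cases a; cases b; cases "f (\<lambda>_. 0)") (auto simp: diag)
  qed
qed

section \<open>Membership in \<open>G_2_3\<close>, and truth tables of the normal forms\<close>

lemma ess_eq_3_iff:
  fixes f :: "(3 \<Rightarrow> bit) \<Rightarrow> bit"
  shows "ess f = 3 \<longleftrightarrow> (\<forall>i. essential f i)"
proof
  assume "ess f = 3"
  then have "Ess f = UNIV"
    by (intro card_subset_eq) (auto simp: ess_def)
  then show "\<forall>i. essential f i"
    by (auto simp: Ess_def)
qed (simp add: ess_def Ess_def)

lemma G_2_3_iff: "f \<in> G_2_3 \<longleftrightarrow> (\<forall>i. essential f i) \<and> self_dual f"
proof (cases "\<forall>i. essential f i")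
  case True
  define S where "S = {ess (minor f i j) | i j. i \<noteq> j}"
  have "S = (\<lambda>(i, j). ess (minor f i j)) ` {(i, j). i \<noteq> j}"
    by (auto simp: S_def)
  moreover have "(1, 2) \<in> {(i, j). i \<noteq> (j::3)}"
    by simp
  ultimately have S: "finite S" "S \<noteq> {}"
    by (simp, blast)
  have ess: "ess f = 3"
    using True ess_eq_3_iff by blast
  \<comment> \<open>All variables being essential, the side conditions in \<open>gap\<close> drop
    out, and gap 2 means that the largest minor arity is 3 - 2 = 1.\<close>
  have "{ess (minor f i j) | i j. i \<in> Ess f \<and> j \<in> Ess f \<and> i \<noteq> j} = S"
    using True by (simp add: S_def Ess_def)
  then have "f \<in> G_2_3 \<longleftrightarrow> Max S = 1"
    by (auto simp: G_2_3_def gap_def ess)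
  also have "\<dots> \<longleftrightarrow> self_dual f"
  proof
    assume "Max S = 1"
    then have "ess (minor f i j) \<le> 1" if "i \<noteq> j" for i j
      using Max_ge[OF S(1)] that by (fastforce simp: S_def)
    moreover obtain x y where "f x \<noteq> f y"
      using True unfolding essential_def by blast
    ultimately show "self_dual f"
      by (rule self_dualI)
  next
    assume "self_dual f"
    then have "S \<subseteq> {1}"
      using self_dual_minor by (auto simp: S_def)
    with S(2) have "S = {1}"
      by blast
    then show "Max S = 1"
      by simp
  qed
  finally show ?thesis
    using True by blast
qed (auto simp: G_2_3_def ess_eq_3_iff)

text \<open>The majority of the three bits \<open>x1 \<up> \<beta>\<close>,
  \<open>x2 \<up> \<beta>\<close> and \<open>x3 \<up> \<alpha>\<close>: the third decides when the
  first two differ.\<close>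

definition first_form :: "bit \<Rightarrow> bit \<Rightarrow> bit \<Rightarrow> bit \<Rightarrow> bit \<Rightarrow> bit" where
  "first_form \<alpha> \<beta> x1 x2 x3 =
    x3 \<up> \<alpha> * (x1 \<up> 0 * x2 \<up> 1 + x1 \<up> 1 * x2 \<up> 0) + x1 \<up> \<beta> * x2 \<up> \<beta>"

text \<open>Equal to \<open>x1 + x2 + x3 \<up> \<alpha>\<close>, so the parity function or its
  complement.\<close>

definition second_form :: "bit \<Rightarrow> bit \<Rightarrow> bit \<Rightarrow> bit \<Rightarrow> bit" where
  "second_form \<alpha> x1 x2 x3 =
    x3 \<up> \<alpha> * (x1 \<up> 0 * x2 \<up> 0 + x1 \<up> 1 * x2 \<up> 1)
    + x3 \<up> (neg \<alpha>) * (x1 \<up> 0 * x2 \<up> 1 + x1 \<up> 1 * x2 \<up> 0)"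

text \<open>Reduces membership to a condition on the eight values of \<open>T\<close>. The bijection
  lets it serve both directions: the identity for the truth table of a given \<open>f\<close>, an
  arbitrary \<open>\<pi>\<close> for a normal form.\<close>

lemma G_2_3_iff_table:
  fixes \<pi> :: "3 \<Rightarrow> 3"
  assumes f: "\<And>x. f x = T (x (\<pi> 1)) (x (\<pi> 2)) (x (\<pi> 3))" and \<pi>: "bij \<pi>"
  shows "f \<in> G_2_3 \<longleftrightarrow>
    (\<exists>b c. T 0 b c \<noteq> T 1 b c) \<and> (\<exists>a c. T a 0 c \<noteq> T a 1 c) \<and> (\<exists>a b. T a b 0 \<noteq> T a b 1) \<and>
    (\<forall>a b c. T (neg a) (neg b) (neg c) = neg (T a b c))"
proof -
  define point where "point a b c l = (if l = \<pi> 1 then a else if l = \<pi> 2 then b else c)"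
    for a b c :: bit and l
  have inj: "\<pi> i = \<pi> j \<longleftrightarrow> i = j" for i j
    using \<pi> by (simp add: bij_def inj_eq)
  have [simp]: "point a b c (\<pi> 1) = a" "point a b c (\<pi> 2) = b" "point a b c (\<pi> 3) = c" for a b c
    by (simp_all add: point_def inj)
  have "essential f (\<pi> i) \<longleftrightarrow> (\<exists>a b c d. f ((point a b c)(\<pi> i := d)) \<noteq> f (point a b c))" for i
  proof -
    have "f (x(\<pi> i := d)) = f ((point (x (\<pi> 1)) (x (\<pi> 2)) (x (\<pi> 3)))(\<pi> i := d))"
      "f x = f (point (x (\<pi> 1)) (x (\<pi> 2)) (x (\<pi> 3)))" for x d
      by (simp_all add: f inj)
    then show ?thesis
      unfolding essential_def by metis
  qed
  then have "essential f (\<pi> 1) \<longleftrightarrow> (\<exists>a b c d. T d b c \<noteq> T a b c)"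
    "essential f (\<pi> 2) \<longleftrightarrow> (\<exists>a b c d. T a d c \<noteq> T a b c)"
    "essential f (\<pi> 3) \<longleftrightarrow> (\<exists>a b c d. T a b d \<noteq> T a b c)"
    by (simp_all add: f inj)
  \<comment> \<open>The old and new values of the changed bit are moved innermost to match
    \<open>ex_bit_neq\<close>.\<close>
  moreover have "(\<exists>a b c d. T d b c \<noteq> T a b c) \<longleftrightarrow> (\<exists>b c a d. T d b c \<noteq> T a b c)"
    "(\<exists>a b c d. T a d c \<noteq> T a b c) \<longleftrightarrow> (\<exists>a c b d. T a d c \<noteq> T a b c)"
    by blast+
  ultimately have e: "essential f (\<pi> 1) \<longleftrightarrow> (\<exists>b c. T 0 b c \<noteq> T 1 b c)"
    "essential f (\<pi> 2) \<longleftrightarrow> (\<exists>a c. T a 0 c \<noteq> T a 1 c)"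
    "essential f (\<pi> 3) \<longleftrightarrow> (\<exists>a b. T a b 0 \<noteq> T a b 1)"
    by (simp_all only: ex_bit_neq[of "\<lambda>a. T a _ _"] ex_bit_neq[of "\<lambda>b. T _ b _"]
        ex_bit_neq[of "T _ _"])
  have "(\<forall>i. essential f i) \<longleftrightarrow> (\<forall>i. essential f (\<pi> i))"
    using \<pi> by (metis bij_is_surj surjD)
  moreover have "self_dual f \<longleftrightarrow> (\<forall>a b c. T (neg a) (neg b) (neg c) = neg (T a b c))"
  proof
    assume sd: "self_dual f"
    have "T (neg a) (neg b) (neg c) = neg (T a b c)" for a b c
      using sd[unfolded self_dual_def, rule_format, of "point a b c"] by (simp add: f)
    then show "\<forall>a b c. T (neg a) (neg b) (neg c) = neg (T a b c)"
      by blast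
  qed (simp add: self_dual_def f)
  ultimately show ?thesis
    by (simp add: G_2_3_iff forall_3 e)
qed

text \<open>Of the 16 self-dual tables, 6 are a variable or its negation, 2 are parities and 8 are
  majorities of possibly negated variables. Two of the three signs of a majority agree, so moving
  the remaining variable to third place gives \<open>first_form\<close>.\<close>

lemma self_dual_table_cases:
  fixes T :: "bit \<Rightarrow> bit \<Rightarrow> bit \<Rightarrow> bit"
  assumes "\<exists>b c. T 0 b c \<noteq> T 1 b c" "\<exists>a c. T a 0 c \<noteq> T a 1 c" "\<exists>a b. T a b 0 \<noteq> T a b 1"
    and sd: "\<forall>a b c. T (neg a) (neg b) (neg c) = neg (T a b c)"
  shows "(\<exists>\<alpha> \<beta>. \<forall>a b c. T a b c = first_form \<alpha> \<beta> a b c) \<or>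
    (\<exists>\<alpha> \<beta>. \<forall>a b c. T a b c = first_form \<alpha> \<beta> c b a) \<or>
    (\<exists>\<alpha> \<beta>. \<forall>a b c. T a b c = first_form \<alpha> \<beta> a c b) \<or>
    (\<exists>\<alpha>. \<forall>a b c. T a b c = second_form \<alpha> a b c)"
proof -
  have "T 1 1 1 = neg (T 0 0 0)" "T 0 1 1 = neg (T 1 0 0)" "T 1 0 1 = neg (T 0 1 0)"
    "T 1 1 0 = neg (T 0 0 1)"
    using sd[rule_format, of 0 0 0] sd[rule_format, of 1 0 0] sd[rule_format, of 0 1 0]
      sd[rule_format, of 0 0 1] by simp_all
  with assms(1-3) show ?thesis
    unfolding ex_bit all_bit var_pow_def first_form_def second_form_def
    by (cases "T 0 0 0"; cases "T 1 0 0"; cases "T 0 1 0"; cases "T 0 0 1") simp_all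
qed

section \<open>Classification up to permutation of the variables\<close>

theorem theorem3p2:
  fixes f :: "(3 \<Rightarrow> bit) \<Rightarrow> bit"
  shows "f \<in> G_2_3 \<longleftrightarrow>
    (\<exists>\<pi> :: 3 \<Rightarrow> 3. bij \<pi> \<and>
      ((\<exists>\<alpha> \<beta>. \<forall>x. f x =
          (let x1 = x (\<pi> 1); x2 = x (\<pi> 2); x3 = x (\<pi> 3) in
            x3 \<up> \<alpha> * (x1 \<up> 0 * x2 \<up> 1 + x1 \<up> 1 * x2 \<up> 0) + x1 \<up> \<beta> * x2 \<up> \<beta>))
       \<or>
       (\<exists>\<alpha>. \<forall>x. f x =
          (let x1 = x (\<pi> 1); x2 = x (\<pi> 2); x3 = x (\<pi> 3) in
            x3 \<up> \<alpha> * (x1 \<up> 0 * x2 \<up> 0 + x1 \<up> 1 * x2 \<up> 1)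
            + x3 \<up> (neg \<alpha>) * (x1 \<up> 0 * x2 \<up> 1 + x1 \<up> 1 * x2 \<up> 0)))))"
    (is "_ \<longleftrightarrow> (\<exists>\<pi>. bij \<pi> \<and> (?first \<pi> \<or> ?second \<pi>))")
proof -
  have first: "?first \<pi> \<longleftrightarrow>
      (\<exists>\<alpha> \<beta>. \<forall>x. f x = first_form \<alpha> \<beta> (x (\<pi> 1)) (x (\<pi> 2)) (x (\<pi> 3)))"
    and second: "?second \<pi> \<longleftrightarrow>
      (\<exists>\<alpha>. \<forall>x. f x = second_form \<alpha> (x (\<pi> 1)) (x (\<pi> 2)) (x (\<pi> 3)))" for \<pi>
    by (simp_all only: Let_def first_form_def second_form_def)
  show ?thesis
    unfolding first second
  proof (intro iffI; (elim exE conjE disjE)?)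
    assume G: "f \<in> G_2_3"
    define T where "T a b c = f (\<lambda>l. if l = 1 then a else if l = 2 then b else c)" for a b c
    have f: "f x = T (x 1) (x 2) (x 3)" for x
    proof -
      have "x = (\<lambda>l. if l = 1 then x 1 else if l = 2 then x 2 else x 3)"
        by (simp add: fun_eq_iff forall_3)
      then show ?thesis
        by (simp add: T_def)
    qed
    have "(\<exists>\<alpha> \<beta>. \<forall>a b c. T a b c = first_form \<alpha> \<beta> a b c) \<or>
      (\<exists>\<alpha> \<beta>. \<forall>a b c. T a b c = first_form \<alpha> \<beta> c b a) \<or>
      (\<exists>\<alpha> \<beta>. \<forall>a b c. T a b c = first_form \<alpha> \<beta> a c b) \<or>
      (\<exists>\<alpha>. \<forall>a b c. T a b c = second_form \<alpha> a b c)"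
      using G G_2_3_iff_table[of f T id] f by (intro self_dual_table_cases) simp_all
    then show "\<exists>\<pi> :: 3 \<Rightarrow> 3. bij \<pi> \<and>
      ((\<exists>\<alpha> \<beta>. \<forall>x. f x = first_form \<alpha> \<beta> (x (\<pi> 1)) (x (\<pi> 2)) (x (\<pi> 3))) \<or>
       (\<exists>\<alpha>. \<forall>x. f x = second_form \<alpha> (x (\<pi> 1)) (x (\<pi> 2)) (x (\<pi> 3))))"
    proof (elim disjE)
      assume "\<exists>\<alpha> \<beta>. \<forall>a b c. T a b c = first_form \<alpha> \<beta> a b c"
      then obtain \<alpha> \<beta> where "\<And>a b c. T a b c = first_form \<alpha> \<beta> a b c"
        by blast
      then have "\<forall>x. f x = first_form \<alpha> \<beta> (x (id 1)) (x (id 2)) (x (id 3))"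
        by (simp add: f)
      then show ?thesis
        using bij_id by blast
    next
      assume "\<exists>\<alpha> \<beta>. \<forall>a b c. T a b c = first_form \<alpha> \<beta> c b a"
      then obtain \<alpha> \<beta> where "\<And>a b c. T a b c = first_form \<alpha> \<beta> c b a"
        by blast
      \<comment> \<open>The transposition puts the variable carrying \<open>\<alpha>\<close>, here
        the first one, in third place.\<close>
      then have "\<forall>x. f x = first_form \<alpha> \<beta> (x (Transposition.transpose 3 1 1))
          (x (Transposition.transpose 3 1 2)) (x (Transposition.transpose 3 1 3))"
        by (simp add: f Transposition.transpose_def)
      then show ?thesis
        using bij_transpose[of 3 1] by blast
    next
      assume "\<exists>\<alpha> \<beta>. \<forall>a b c. T a b c = first_form \<alpha> \<beta> a c b"
      then obtain \<alpha> \<beta> where "\<And>a b c. T a b c = first_form \<alpha> \<beta> a c b"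
        by blast
      then have "\<forall>x. f x = first_form \<alpha> \<beta> (x (Transposition.transpose 3 2 1))
          (x (Transposition.transpose 3 2 2)) (x (Transposition.transpose 3 2 3))"
        by (simp add: f Transposition.transpose_def)
      then show ?thesis
        using bij_transpose[of 3 2] by blast
    next
      assume "\<exists>\<alpha>. \<forall>a b c. T a b c = second_form \<alpha> a b c"
      then obtain \<alpha> where "\<And>a b c. T a b c = second_form \<alpha> a b c"
        by blast
      then have "\<forall>x. f x = second_form \<alpha> (x (id 1)) (x (id 2)) (x (id 3))"
        by (simp add: f)
      then show ?thesis
        using bij_id by blast
    qed
  next
    fix \<pi> :: "3 \<Rightarrow> 3" and \<alpha> \<beta>
    assume \<pi>: "bij \<pi>"
      and f: "\<forall>x. f x = first_form \<alpha> \<beta> (x (\<pi> 1)) (x (\<pi> 2)) (x (\<pi> 3))"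
    \<comment> \<open>The table criterion absorbs \<open>\<pi>\<close>, leaving finitely many
      evaluations of the normal form.\<close>
    show "f \<in> G_2_3"
      unfolding G_2_3_iff_table[of f "first_form \<alpha> \<beta>", OF f[rule_format] \<pi>]
        ex_bit all_bit var_pow_def first_form_def
      by (cases \<alpha>; cases \<beta>) simp_all
  next
    fix \<pi> :: "3 \<Rightarrow> 3" and \<alpha>
    assume \<pi>: "bij \<pi>"
      and f: "\<forall>x. f x = second_form \<alpha> (x (\<pi> 1)) (x (\<pi> 2)) (x (\<pi> 3))"
    show "f \<in> G_2_3"
      unfolding G_2_3_iff_table[of f "second_form \<alpha>", OF f[rule_format] \<pi>]
        ex_bit all_bit var_pow_def second_form_def
      by (cases \<alpha>) simp_all
  qed
qed

end
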